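(* Fix matrices $A\in\mathbb R^{m\times k}$ and $B\in\mathbb R^{k\times n}$, let $C=AB$, and let $\widehat C$ be the computed product in which every entry is obtained by accumulating its $k$ products on the same full binary tree $T$ under the conditionally unbiased rounding model described in the context. Let $\Sigma_p(A,B)$ be the sum, over all output entries and all rounded product leaves, of the expected conditional variances of the product rounding errors, and let $\Sigma_a(A,B)$ be the sum, over all output entries and all accumulation (internal) nodes, of the expected conditional variances of the accumulation rounding errors. Then $$\mathbb E_\xi\bigl[\|\widehat C-C\|_F^2\mid A,B\bigr]=\Sigma_p(A,B)+\Sigma_a(A,B).$$
   Context: $T$ is a full binary tree (every internal node has exactly two children) with $k$ leaves. For each output entry $(i,j)$, leaf $\ell$ carries the exact product $p_\ell=A_{i\ell}B_{\ell j}$, and the rounding model below is applied to the reduction of $p=(p_1,\dots,p_k)$ on $T$, with root value $\widehat C_{ij}$. $\mathbb E_\xi$ is expectation over rounding variables with the operands fixed. Conditionally unbiased rounding model (for one output entry). For a node $v$, $q_v$ is the exact sum of the leaf values below $v$, $\widehat q_v$ the computed value, $e_v=\widehat q_v-q_v$. At each internal node $v$ with children $v_1,v_2$ there is a possibly random rounding map $\operatorname{fl}_v$; the pre-rounding value is $x_v=\widehat q_{v_1}+\widehat q_{v_2}=q_v+e_{v_1}+e_{v_2}$, the computed value is $\widehat q_v=\operatorname{fl}_v(x_v)$, and the local error is $\xi_v=\operatorname{fl}_v(x_v)-x_v$. Let $\mathcal F_v^-$ be the $\sigma$-algebra generated by the fixed input and all rounding draws in the two child subtrees of $v$. It is assumed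 that $\mathbb E_\xi[\xi_v\mid\mathcal F_v^-]=0$ and $\mathbb E_\xi[\xi_v^2\mid\mathcal F_v^-]=\psi_v(x_v)\ge0$, and that rounding draws in disjoint subtrees are independent conditional on the input. A leaf is either exact ($\widehat q_\ell=p_\ell$) or a rounded product leaf, $\widehat q_\ell=p_\ell+\xi^{(p)}_\ell$ with $\mathbb E_\xi[\xi^{(p)}_\ell\mid p_\ell]=0$ and conditional variance $\mathbb E_\xi[(\xi^{(p)}_\ell)^2\mid p_\ell]$; product rounding errors are independent across leaves and independent of later accumulation draws. All rounding errors have finite second moments. The expected conditional variance at an internal node $v$ is $\mathbb E_\xi[\psi_v(x_v)\mid A,B]$. *)

theory Defs
  imports "HOL-Probability.Probability"
begin

(* A node of a tree is represented by the subtree rooted at it.  This identification is injective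
   once the leaf labels are pairwise distinct, which full_tree_on requires. *)

datatype 'l sum_tree = Tip 'l | Branch "'l sum_tree" "'l sum_tree"

primrec leaf_list :: "'l sum_tree \<Rightarrow> 'l list" where
  "leaf_list (Tip l) = [l]"
| "leaf_list (Branch a b) = leaf_list a @ leaf_list b"

definition full_tree_on :: "'l set \<Rightarrow> 'l sum_tree \<Rightarrow> bool" where
  "full_tree_on L t \<longleftrightarrow> distinct (leaf_list t) \<and> set (leaf_list t) = L"

primrec subtrees :: "'l sum_tree \<Rightarrow> 'l sum_tree set" where
  "subtrees (Tip l) = {Tip l}"
| "subtrees (Branch a b) = insert (Branch a b) (subtrees a \<union> subtrees b)"

definition internal_nodes :: "'l sum_tree \<Rightarrow> 'l sum_tree set" where
  "internal_nodes t = {v \<in> subtrees t. \<exists>a b. v = Branch a b}"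

(* Data of the rounding procedure for one output entry on the sample space 'w.  The random map fl_v
   is given by a draw U_v with values in some measurable space and a map rnd_v, with
   fl_v(x) = rnd_v(U_v, x).  The components prod_err and draw, draw_space, rnd, cond_var are only
   meaningful at rounded leaves and at internal nodes, respectively. *)

record ('l, 'w, 'd) rounding =
  rounded :: "'l set"
  prod_err :: "'l \<Rightarrow> 'w \<Rightarrow> real"
  draw_space :: "'l sum_tree \<Rightarrow> 'd measure"
  draw :: "'l sum_tree \<Rightarrow> 'w \<Rightarrow> 'd"
  rnd :: "'l sum_tree \<Rightarrow> 'd \<Rightarrow> real \<Rightarrow> real"
  cond_var :: "'l sum_tree \<Rightarrow> real \<Rightarrow> real"

definition fl :: "('l, 'w, 'd) rounding \<Rightarrow> 'l sum_tree \<Rightarrow> 'w \<Rightarrow> real \<Rightarrow> real" where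
  "fl r v \<omega> x = rnd r v (draw r v \<omega>) x"

primrec computed ::
  "('l, 'w, 'd) rounding \<Rightarrow> ('l \<Rightarrow> real) \<Rightarrow> 'l sum_tree \<Rightarrow> 'w \<Rightarrow> real" where
  "computed r p (Tip l) \<omega> = (if l \<in> rounded r then p l + prod_err r l \<omega> else p l)"
| "computed r p (Branch a b) \<omega> =
     fl r (Branch a b) \<omega> (computed r p a \<omega> + computed r p b \<omega>)"

(* The values of pre_rounding and child_nodes at a Tip are never used. *)

primrec pre_rounding ::
  "('l, 'w, 'd) rounding \<Rightarrow> ('l \<Rightarrow> real) \<Rightarrow> 'l sum_tree \<Rightarrow> 'w \<Rightarrow> real" where
  "pre_rounding r p (Tip l) \<omega> = p l"
| "pre_rounding r p (Branch a b) \<omega> = computed r p a \<omega> + computed r p b \<omega>"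

primrec child_nodes :: "'l sum_tree \<Rightarrow> 'l sum_tree set" where
  "child_nodes (Tip l) = {}"
| "child_nodes (Branch a b) = subtrees a \<union> subtrees b"

definition local_err ::
  "('l, 'w, 'd) rounding \<Rightarrow> ('l \<Rightarrow> real) \<Rightarrow> 'l sum_tree \<Rightarrow> 'w \<Rightarrow> real" where
  "local_err r p v \<omega> = fl r v \<omega> (pre_rounding r p v \<omega>) - pre_rounding r p v \<omega>"

primrec node_events ::
  "'w measure \<Rightarrow> ('l, 'w, 'd) rounding \<Rightarrow> 'l sum_tree \<Rightarrow> 'w set set" where
  "node_events M r (Tip l) =
     (if l \<in> rounded r then {prod_err r l -` S \<inter> space M | S. S \<in> sets borel} else {})"
| "node_events M r (Branch a b) =
     {draw r (Branch a b) -` S \<inter> space M | S. S \<in> sets (draw_space r (Branch a b))}"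

definition draw_algebra ::
  "'w measure \<Rightarrow> ('l, 'w, 'd) rounding \<Rightarrow> 'l sum_tree set \<Rightarrow> 'w measure" where
  "draw_algebra M r V = sigma (space M) (\<Union>v\<in>V. node_events M r v)"

(* The sigma-algebra F_v^-.  The fixed input is constant on the sample space and hence
   contributes only trivial events. *)

definition past_algebra ::
  "'w measure \<Rightarrow> ('l, 'w, 'd) rounding \<Rightarrow> 'l sum_tree \<Rightarrow> 'w measure" where
  "past_algebra M r v = draw_algebra M r (child_nodes v)"

(* The sigma-algebra generated by the exact product p_l, trivial because the operands are fixed. *)

definition product_algebra :: "'w measure \<Rightarrow> real \<Rightarrow> 'w measure" where
  "product_algebra M c = vimage_algebra (space M) (\<lambda>_. c) borel"

(* The conditionally unbiased rounding model for one output entry.  M is the law of the rounding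
   variables with the operands fixed, so independence conditional on the input is independence
   under M.  The accumulation draws later than a product rounding error at l are those at the
   internal nodes above l. *)

locale unbiased_rounding = prob_space M
  for M :: "'w measure"
    and T :: "'l sum_tree"
    and p :: "'l \<Rightarrow> real"
    and r :: "('l, 'w, 'd) rounding" +
  assumes rounded_subset: "rounded r \<subseteq> set (leaf_list T)"
    and prod_err_measurable: "\<And>l. l \<in> rounded r \<Longrightarrow> prod_err r l \<in> borel_measurable M"
    and draw_measurable: "\<And>v. v \<in> internal_nodes T \<Longrightarrow> draw r v \<in> measurable M (draw_space r v)"
    and rnd_measurable: "\<And>v. v \<in> internal_nodes T \<Longrightarrow>
          (\<lambda>(d, x). rnd r v d x) \<in> borel_measurable (draw_space r v \<Otimes>\<^sub>M borel)"
    and cond_var_measurable: "\<And>v. v \<in> internal_nodes T \<Longrightarrow> cond_var r v \<in> borel_measurable borel"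
    and prod_err_square_integrable: "\<And>l. l \<in> rounded r \<Longrightarrow>
          integrable M (\<lambda>\<omega>. (prod_err r l \<omega>)\<^sup>2)"
    and local_err_square_integrable: "\<And>v. v \<in> internal_nodes T \<Longrightarrow>
          integrable M (\<lambda>\<omega>. (local_err r p v \<omega>)\<^sup>2)"
    and prod_err_unbiased: "\<And>l. l \<in> rounded r \<Longrightarrow>
          AE \<omega> in M. real_cond_exp M (product_algebra M (p l)) (prod_err r l) \<omega> = 0"
    and local_err_unbiased: "\<And>v. v \<in> internal_nodes T \<Longrightarrow>
          AE \<omega> in M. real_cond_exp M (past_algebra M r v) (local_err r p v) \<omega> = 0"
    and local_err_variance: "\<And>v. v \<in> internal_nodes T \<Longrightarrow>
          AE \<omega> in M. real_cond_exp M (past_algebra M r v) (\<lambda>\<omega>. (local_err r p v \<omega>)\<^sup>2) \<omega>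
                        = cond_var r v (pre_rounding r p v \<omega>)
                     \<and> 0 \<le> cond_var r v (pre_rounding r p v \<omega>)"
    and disjoint_subtrees_indep: "\<And>s t. s \<in> subtrees T \<Longrightarrow> t \<in> subtrees T \<Longrightarrow>
          set (leaf_list s) \<inter> set (leaf_list t) = {} \<Longrightarrow>
          indep_set (sets (draw_algebra M r (subtrees s))) (sets (draw_algebra M r (subtrees t)))"
    and prod_err_indep: "indep_vars (\<lambda>_. borel) (prod_err r) (rounded r)"
    and prod_err_later_indep: "\<And>l. l \<in> rounded r \<Longrightarrow>
          indep_set (sets (draw_algebra M r {Tip l}))
            (sets (draw_algebra M r {v \<in> internal_nodes T. l \<in> set (leaf_list v)}))"

definition exact_prod :: "real^'k^'m \<Rightarrow> real^'n^'k \<Rightarrow> 'm \<Rightarrow> 'n \<Rightarrow> 'k \<Rightarrow> real" where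
  "exact_prod A B i j l = A $ i $ l * B $ l $ j"

definition computed_matrix ::
  "('m \<Rightarrow> 'n \<Rightarrow> ('k, 'w, 'd) rounding) \<Rightarrow> 'k sum_tree \<Rightarrow> real^'k^'m \<Rightarrow> real^'n^'k
     \<Rightarrow> 'w \<Rightarrow> real^'n^'m" where
  "computed_matrix R T A B \<omega> = (\<chi> i j. computed (R i j) (exact_prod A B i j) T \<omega>)"

definition Sigma_p ::
  "'w measure \<Rightarrow> ('m::finite \<Rightarrow> 'n::finite \<Rightarrow> ('k, 'w, 'd) rounding)
     \<Rightarrow> real^'k^'m \<Rightarrow> real^'n^'k \<Rightarrow> real" where
  "Sigma_p M R A B = (\<Sum>i\<in>UNIV. \<Sum>j\<in>UNIV. \<Sum>l\<in>rounded (R i j).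
     \<integral>\<omega>. real_cond_exp M (product_algebra M (exact_prod A B i j l))
            (\<lambda>\<omega>. (prod_err (R i j) l \<omega>)\<^sup>2) \<omega> \<partial>M)"

definition Sigma_a ::
  "'w measure \<Rightarrow> ('m::finite \<Rightarrow> 'n::finite \<Rightarrow> ('k, 'w, 'd) rounding) \<Rightarrow> 'k sum_tree
     \<Rightarrow> real^'k^'m \<Rightarrow> real^'n^'k \<Rightarrow> real" where
  "Sigma_a M R T A B = (\<Sum>i\<in>UNIV. \<Sum>j\<in>UNIV. \<Sum>v\<in>internal_nodes T.
     \<integral>\<omega>. cond_var (R i j) v (pre_rounding (R i j) (exact_prod A B i j) v \<omega>) \<partial>M)"

(* The library norm on matrices of type real^'n^'m is the Frobenius norm. *)

lemma norm_matrix_eq_Frobenius: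
  fixes X :: "real^'n^'m"
  shows "norm X = sqrt (\<Sum>i\<in>UNIV. \<Sum>j\<in>UNIV. (X $ i $ j)\<^sup>2)"
  by (simp add: norm_vec_def L2_set_def sum_nonneg)

end

theory Submission
  imports Defs
begin

text \<open>
  Summing the recursion \<open>e\<^sub>v = e\<^sub>a + e\<^sub>b + \<xi>\<^sub>v\<close> for the error at a node \<open>v\<close> with children \<open>a\<close>, \<open>b\<close>
  gives the mean squared error once the cross terms vanish: \<open>e\<^sub>a\<close> and \<open>e\<^sub>b\<close> are centred and
  independent, because they depend on draws in disjoint subtrees, and \<open>\<xi>\<^sub>v\<close> is orthogonal to
  \<open>e\<^sub>a + e\<^sub>b\<close>, which is measurable with respect to the past of \<open>v\<close>. Hence the mean squared error
  at the root is the sum of the second moments of all rounding errors.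
\<close>

section \<open>Subtrees, leaves and internal nodes\<close>

lemma subtrees_refl [simp]: "s \<in> subtrees s"
  by (cases s) auto

lemma subtrees_trans: "s \<in> subtrees t \<Longrightarrow> t \<in> subtrees u \<Longrightarrow> s \<in> subtrees u"
  by (induction u) auto

lemma subtrees_children:
  assumes "Branch a b \<in> subtrees t"
  shows "a \<in> subtrees t" "b \<in> subtrees t"
  using subtrees_trans[OF _ assms] by simp_all

lemma finite_subtrees [simp]: "finite (subtrees s)"
  by (induction s) auto

lemma leaf_list_ne [simp]: "leaf_list s \<noteq> []"
  by (induction s) auto

lemma set_leaf_list_subtree: "s \<in> subtrees t \<Longrightarrow> set (leaf_list s) \<subseteq> set (leaf_list t)"
  by (induction t) auto

lemma distinct_leaf_list_subtree:
  "s \<in> subtrees t \<Longrightarrow> distinct (leaf_list t) \<Longrightarrow> distinct (leaf_list s)"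
  by (induction t) auto

lemma size_subtree: "s \<in> subtrees t \<Longrightarrow> size s \<le> size t"
  by (induction t) auto

lemma finite_internal_nodes [simp]: "finite (internal_nodes s)"
  by (simp add: internal_nodes_def)

lemma internal_nodes_Tip [simp]: "internal_nodes (Tip l) = {}"
  by (auto simp: internal_nodes_def)

lemma internal_nodes_Branch:
  "internal_nodes (Branch a b) = insert (Branch a b) (internal_nodes a \<union> internal_nodes b)"
  by (auto simp: internal_nodes_def)

text \<open>Nodes are identified with subtrees, so the three parts must be shown disjoint. The root
  is too large to occur below itself, and a subtree common to \<open>a\<close> and \<open>b\<close>
  would have a leaf in both, against distinctness of the labels.\<close>

lemma sum_internal_nodes_Branch:
  assumes "distinct (leaf_list (Branch a b))"
  shows "sum f (internal_nodes (Branch a b))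
           = f (Branch a b) + sum f (internal_nodes a) + sum f (internal_nodes b)"
proof -
  have "Branch a b \<notin> subtrees a" "Branch a b \<notin> subtrees b"
    by (auto dest: size_subtree)
  then have "Branch a b \<notin> internal_nodes a \<union> internal_nodes b"
    by (auto simp: internal_nodes_def)
  moreover have "internal_nodes a \<inter> internal_nodes b = {}"
  proof -
    have "x \<notin> subtrees b" if "x \<in> subtrees a" for x
    proof
      assume "x \<in> subtrees b"
      with that have "set (leaf_list x) \<subseteq> set (leaf_list a) \<inter> set (leaf_list b)"
        using set_leaf_list_subtree by blast
      also have "\<dots> = {}"
        using assms by simp
      finally show False
        by simp
    qed
    then show ?thesis
      by (auto simp: internal_nodes_def)
  qed
  ultimately show ?thesis
    by (simp add: internal_nodes_Branch sum.union_disjoint add.assoc)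
qed

section \<open>Products and sums of square-integrable functions\<close>

lemma integrable_mult_square_integrable:
  fixes f g :: "'a \<Rightarrow> real"
  assumes [measurable]: "f \<in> borel_measurable M" "g \<in> borel_measurable M"
    and f: "integrable M (\<lambda>x. (f x)\<^sup>2)" and g: "integrable M (\<lambda>x. (g x)\<^sup>2)"
  shows "integrable M (\<lambda>x. f x * g x)"
proof (rule Bochner_Integration.integrable_bound)
  show "integrable M (\<lambda>x. (f x)\<^sup>2 + (g x)\<^sup>2)"
    using f g by simp
  have "\<bar>a * b\<bar> \<le> a\<^sup>2 + b\<^sup>2" for a b :: real
  proof -
    have "2 * (\<bar>a\<bar> * \<bar>b\<bar>) \<le> a\<^sup>2 + b\<^sup>2"
      using sum_squares_bound[of "\<bar>a\<bar>" "\<bar>b\<bar>"] by simp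
    moreover have "0 \<le> \<bar>a\<bar> * \<bar>b\<bar>"
      by simp
    ultimately show ?thesis
      unfolding abs_mult by linarith
  qed
  then show "AE x in M. norm (f x * g x) \<le> norm ((f x)\<^sup>2 + (g x)\<^sup>2)"
    by simp
qed simp

lemma integrable_add_square:
  fixes f g :: "'a \<Rightarrow> real"
  assumes "f \<in> borel_measurable M" "g \<in> borel_measurable M"
    and "integrable M (\<lambda>x. (f x)\<^sup>2)" "integrable M (\<lambda>x. (g x)\<^sup>2)"
  shows "integrable M (\<lambda>x. (f x + g x)\<^sup>2)"
  using assms integrable_mult_square_integrable[OF assms]
  by (simp add: power2_sum mult.assoc)

lemma integral_add_square_orthogonal:
  fixes f g :: "'a \<Rightarrow> real"
  assumes "f \<in> borel_measurable M" "g \<in> borel_measurable M"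
    and "integrable M (\<lambda>x. (f x)\<^sup>2)" "integrable M (\<lambda>x. (g x)\<^sup>2)"
    and "(\<integral>x. f x * g x \<partial>M) = 0"
  shows "(\<integral>x. (f x + g x)\<^sup>2 \<partial>M) = (\<integral>x. (f x)\<^sup>2 \<partial>M) + (\<integral>x. (g x)\<^sup>2 \<partial>M)"
  using assms integrable_mult_square_integrable[OF assms(1-4)]
  by (simp add: power2_sum mult.assoc)

text \<open>The preimages under \<open>X\<close> and \<open>Y\<close> generate sub-sigma-algebras of
  \<open>F\<close> and \<open>G\<close>, so they inherit independence. This turns independence of
  draws in disjoint subtrees into independence of the errors computed from them.\<close>

lemma (in prob_space) indep_set_imp_indep_var:
  assumes F: "subalgebra M F" and G: "subalgebra M G"
    and FG: "indep_set (sets F) (sets G)"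
    and X: "X \<in> measurable F S" and Y: "Y \<in> measurable G N"
  shows "indep_var S X N Y"
proof -
  have "sigma_sets (space M) {Z -` A \<inter> space M |A. A \<in> sets K} \<subseteq> sets H"
    if "subalgebra M H" "Z \<in> measurable H K" for Z :: "'a \<Rightarrow> 'z" and H K
    using that sets.sigma_sets_subset[of "{Z -` A \<inter> space M |A. A \<in> sets K}" H]
      measurable_sets[of Z H K]
    by (fastforce simp: subalgebra_def)
  note sub = this
  have "indep_set (sigma_sets (space M) {X -` A \<inter> space M |A. A \<in> sets S})
          (sigma_sets (space M) {Y -` A \<inter> space M |A. A \<in> sets N})"
    using FG sub[OF F X] sub[OF G Y] unfolding indep_set_def
    by (elim indep_sets_mono_sets) (auto split: bool.split)
  then show ?thesis
    using measurable_from_subalg[OF F X] measurable_from_subalg[OF G Y]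
    by (simp add: indep_var_eq)
qed

section \<open>Sigma-algebras generated by rounding draws\<close>

context unbiased_rounding
begin

text \<open>The error \<open>e_v\<close> of the model. The sum over the set of leaves is the exact
  partial sum whenever the labels are distinct.\<close>

definition node_err :: "'l sum_tree \<Rightarrow> 'w \<Rightarrow> real" where
  "node_err s \<omega> = computed r p s \<omega> - (\<Sum>l\<in>set (leaf_list s). p l)"

lemma node_events_sets:
  assumes "v \<in> subtrees T"
  shows "node_events M r v \<subseteq> sets M"
proof (cases v)
  case (Tip l)
  then show ?thesis
    using measurable_sets[OF prod_err_measurable] by auto
next
  case (Branch a b)
  with assms have "v \<in> internal_nodes T"
    by (auto simp: internal_nodes_def)
  then show ?thesis
    using measurable_sets[OF draw_measurable] Branch by auto
qed

text \<open>For generators outside the powerset of the space, \<open>sigma\<close> falls back to the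
  trivial sigma-algebra; this inclusion makes \<open>draw_algebra\<close> the one generated by the
  node events.\<close>

lemma node_events_Pow: "(\<Union>v\<in>V. node_events M r v) \<subseteq> Pow (space M)"
proof -
  have "node_events M r v \<subseteq> Pow (space M)" for v
    by (cases v) auto
  then show ?thesis
    by blast
qed

lemma space_draw_algebra [simp]: "space (draw_algebra M r V) = space M"
  by (simp add: draw_algebra_def space_measure_of_conv)

lemma sets_draw_algebra:
  "sets (draw_algebra M r V) = sigma_sets (space M) (\<Union>v\<in>V. node_events M r v)"
  using node_events_Pow by (simp add: draw_algebra_def)

lemma subalgebra_draw_algebra:
  assumes "V \<subseteq> subtrees T"
  shows "subalgebra M (draw_algebra M r V)"
proof -
  have "(\<Union>v\<in>V. node_events M r v) \<subseteq> sets M"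
    using assms node_events_sets by blast
  then show ?thesis
    by (auto simp: subalgebra_def sets_draw_algebra dest: sets.sigma_sets_subset)
qed

lemma finite_measure_subalgebra_draw_algebra:
  "V \<subseteq> subtrees T \<Longrightarrow> finite_measure_subalgebra M (draw_algebra M r V)"
  using subalgebra_draw_algebra
  by (simp add: finite_measure_subalgebra_def finite_measure_subalgebra_axioms_def
      finite_measure_axioms)

lemma finite_measure_subalgebra_product_algebra:
  "finite_measure_subalgebra M (product_algebra M c)"
proof -
  have "subalgebra M (product_algebra M c)"
    unfolding subalgebra_def product_algebra_def
    by (auto simp: sets_vimage_algebra2)
  then show ?thesis
    by (simp add: finite_measure_subalgebra_def finite_measure_subalgebra_axioms_def
        finite_measure_axioms)
qed

lemma prod_err_measurable_draw_algebra:
  assumes "Tip l \<in> V" "l \<in> rounded r"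
  shows "prod_err r l \<in> borel_measurable (draw_algebra M r V)"
proof (rule measurableI)
  fix S :: "real set" assume "S \<in> sets borel"
  then have "prod_err r l -` S \<inter> space M \<in> (\<Union>v\<in>V. node_events M r v)"
    using assms by (intro UN_I[of "Tip l"]) auto
  then show "prod_err r l -` S \<inter> space (draw_algebra M r V) \<in> sets (draw_algebra M r V)"
    by (auto simp: sets_draw_algebra)
qed simp

lemma draw_measurable_draw_algebra:
  assumes "v \<in> V" "v \<in> internal_nodes T"
  shows "draw r v \<in> measurable (draw_algebra M r V) (draw_space r v)"
proof (rule measurableI)
  fix \<omega> assume "\<omega> \<in> space (draw_algebra M r V)"
  then show "draw r v \<omega> \<in> space (draw_space r v)"
    using measurable_space[OF draw_measurable[OF assms(2)]] by simp
next
  fix S assume "S \<in> sets (draw_space r v)"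
  moreover obtain a b where "v = Branch a b"
    using assms(2) by (auto simp: internal_nodes_def)
  ultimately have "draw r v -` S \<inter> space M \<in> (\<Union>v\<in>V. node_events M r v)"
    using assms by (intro UN_I[of v]) auto
  then show "draw r v -` S \<inter> space (draw_algebra M r V) \<in> sets (draw_algebra M r V)"
    by (auto simp: sets_draw_algebra)
qed

text \<open>The value at \<open>s\<close> depends only on draws at nodes of \<open>s\<close>. With
  \<open>V\<close> any superset of these nodes, one statement covers both the algebra of
  \<open>s\<close> itself, used for independence, and the past of a parent, used for
  orthogonality.\<close>

lemma computed_measurable:
  "s \<in> subtrees T \<Longrightarrow> subtrees s \<subseteq> V \<Longrightarrow>
     computed r p s \<in> borel_measurable (draw_algebra M r V)"
proof (induction s)
  case (Tip l)
  then show ?case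
    using prod_err_measurable_draw_algebra[of l V] by (cases "l \<in> rounded r") auto
next
  case (Branch a b)
  let ?v = "Branch a b"
  have v: "?v \<in> internal_nodes T"
    using Branch.prems by (auto simp: internal_nodes_def)
  have [measurable]: "computed r p a \<in> borel_measurable (draw_algebra M r V)"
    "computed r p b \<in> borel_measurable (draw_algebra M r V)"
    using Branch subtrees_children[OF Branch.prems(1)] by auto
  have [measurable]: "draw r ?v \<in> measurable (draw_algebra M r V) (draw_space r ?v)"
    using Branch.prems v by (intro draw_measurable_draw_algebra) auto
  have [measurable]: "(\<lambda>(d, x). rnd r ?v d x) \<in> borel_measurable (draw_space r ?v \<Otimes>\<^sub>M borel)"
    by (rule rnd_measurable[OF v])
  \<comment> \<open>A random map is evaluated at a random point, so the value is written as the
    jointly measurable \<open>rnd\<close> composed with the pair of draw and pre-rounding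
    value.\<close>
  have "(\<lambda>\<omega>. (\<lambda>(d, x). rnd r ?v d x) (draw r ?v \<omega>, computed r p a \<omega> + computed r p b \<omega>))
          \<in> borel_measurable (draw_algebra M r V)"
    by measurable
  then show ?case
    by (simp add: fl_def)
qed

lemma node_err_measurable:
  "s \<in> subtrees T \<Longrightarrow> subtrees s \<subseteq> V \<Longrightarrow> node_err s \<in> borel_measurable (draw_algebra M r V)"
  unfolding node_err_def[abs_def] using computed_measurable by simp

section \<open>First and second moments of the errors\<close>

lemma prod_err_moments:
  assumes "l \<in> rounded r"
  shows "expectation (prod_err r l) = 0"
    and "expectation (\<lambda>\<omega>. (prod_err r l \<omega>)\<^sup>2)
      = expectation (real_cond_exp M (product_algebra M (p l)) (\<lambda>\<omega>. (prod_err r l \<omega>)\<^sup>2))"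
proof -
  interpret F: finite_measure_subalgebra M "product_algebra M (p l)"
    by (rule finite_measure_subalgebra_product_algebra)
  have "integrable M (prod_err r l)"
    using assms prod_err_measurable prod_err_square_integrable
    by (blast intro: square_integrable_imp_integrable)
  then have "expectation (prod_err r l)
      = expectation (real_cond_exp M (product_algebra M (p l)) (prod_err r l))"
    by (simp add: F.real_cond_exp_int)
  also have "\<dots> = 0"
    using prod_err_unbiased[OF assms] by (simp add: integral_eq_zero_AE)
  finally show "expectation (prod_err r l) = 0" .
  show "expectation (\<lambda>\<omega>. (prod_err r l \<omega>)\<^sup>2)
      = expectation (real_cond_exp M (product_algebra M (p l)) (\<lambda>\<omega>. (prod_err r l \<omega>)\<^sup>2))"
    by (simp add: F.real_cond_exp_int prod_err_square_integrable[OF assms])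
qed

text \<open>The three claims are proved in one induction: square integrability makes the cross terms
  integrable, and a vanishing mean makes the cross term of two independent child errors
  vanish.\<close>

lemma node_err_moments:
  assumes "distinct (leaf_list T)" "s \<in> subtrees T"
  shows "integrable M (\<lambda>\<omega>. (node_err s \<omega>)\<^sup>2) \<and> expectation (node_err s) = 0 \<and>
    expectation (\<lambda>\<omega>. (node_err s \<omega>)\<^sup>2)
      = (\<Sum>l\<in>rounded r \<inter> set (leaf_list s).
           expectation (real_cond_exp M (product_algebra M (p l)) (\<lambda>\<omega>. (prod_err r l \<omega>)\<^sup>2)))
        + (\<Sum>v\<in>internal_nodes s. expectation (\<lambda>\<omega>. cond_var r v (pre_rounding r p v \<omega>)))"
  using assms(2)
proof (induction s)
  case (Tip l)
  \<comment> \<open>An exact leaf has zero error and an empty sum on the right; a rounded leaf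
    contributes exactly its own product error.\<close>
  have "node_err (Tip l) = (if l \<in> rounded r then prod_err r l else (\<lambda>_. 0))"
    by (auto simp: node_err_def)
  then show ?case
    using prod_err_moments[of l] prod_err_square_integrable[of l] by auto
next
  case (Branch a b)
  let ?v = "Branch a b" and ?F = "past_algebra M r (Branch a b)"
  let ?\<xi> = "local_err r p ?v"
  have sub: "a \<in> subtrees T" "b \<in> subtrees T"
    using subtrees_children[OF Branch.prems] .
  have v: "?v \<in> internal_nodes T"
    using Branch.prems by (auto simp: internal_nodes_def)
  have dist: "distinct (leaf_list ?v)"
    using distinct_leaf_list_subtree[OF Branch.prems assms(1)] .
  then have disj: "set (leaf_list a) \<inter> set (leaf_list b) = {}"
    by simp
  note IHa = Branch.IH(1)[OF sub(1)] and IHb = Branch.IH(2)[OF sub(2)]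
  have past: "child_nodes ?v \<subseteq> subtrees T"
    using sub by (auto intro: subtrees_trans)
  interpret F: finite_measure_subalgebra M ?F
    unfolding past_algebra_def by (rule finite_measure_subalgebra_draw_algebra[OF past])
  have measF: "node_err a \<in> borel_measurable ?F" "node_err b \<in> borel_measurable ?F"
    unfolding past_algebra_def using sub by (auto intro!: node_err_measurable)
  have compM: "computed r p s \<in> borel_measurable M" if "s \<in> subtrees T" for s
    using measurable_from_subalg[OF subalgebra_draw_algebra computed_measurable, of "subtrees s" s]
      that subtrees_trans by blast
  note [measurable] = compM[OF sub(1)] compM[OF sub(2)] compM[OF Branch.prems]
    cond_var_measurable[OF v]
  have [measurable]: "node_err a \<in> borel_measurable M" "node_err b \<in> borel_measurable M"
    unfolding node_err_def[abs_def] by measurable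
  have xi_eq: "?\<xi> = (\<lambda>\<omega>. computed r p ?v \<omega> - (computed r p a \<omega> + computed r p b \<omega>))"
    by (auto simp: local_err_def)
  have [measurable]: "?\<xi> \<in> borel_measurable M"
    unfolding xi_eq by measurable
  let ?e = "\<lambda>\<omega>. node_err a \<omega> + node_err b \<omega>"
  \<comment> \<open>The recursion for the error: the exact sums cancel because the leaf sets of the
    children are disjoint.\<close>
  have split: "node_err ?v = (\<lambda>\<omega>. ?e \<omega> + ?\<xi> \<omega>)"
    using disj by (auto simp: node_err_def xi_eq sum.union_disjoint)
  have int: "integrable M (node_err a)" "integrable M (node_err b)" "integrable M ?\<xi>"
    using IHa IHb local_err_square_integrable[OF v]
    by (auto intro: square_integrable_imp_integrable)

  have "indep_var borel (node_err a) borel (node_err b)"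
    using sub disj subtrees_trans
    by (intro indep_set_imp_indep_var[OF subalgebra_draw_algebra subalgebra_draw_algebra
          disjoint_subtrees_indep[of a b] node_err_measurable node_err_measurable]) auto
  then have cross_ab: "expectation (\<lambda>\<omega>. node_err a \<omega> * node_err b \<omega>) = 0"
    using indep_var_lebesgue_integral[OF _ int(1,2)] IHa by simp
  have int_e2: "integrable M (\<lambda>\<omega>. (?e \<omega>)\<^sup>2)"
    using IHa IHb by (intro integrable_add_square) auto
  have int_ex: "integrable M (\<lambda>\<omega>. ?e \<omega> * ?\<xi> \<omega>)"
    using int_e2 local_err_square_integrable[OF v]
    by (intro integrable_mult_square_integrable) auto
  have unb: "AE \<omega> in M. real_cond_exp M ?F ?\<xi> \<omega> = 0"
    by (rule local_err_unbiased[OF v])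
  \<comment> \<open>The child errors are measurable with respect to the past, so under the
    expectation the local error may be replaced by its conditional expectation, which is
    zero.\<close>
  have "expectation (\<lambda>\<omega>. ?e \<omega> * ?\<xi> \<omega>) = expectation (\<lambda>\<omega>. ?e \<omega> * real_cond_exp M ?F ?\<xi> \<omega>)"
    using measF int_ex by (intro F.real_cond_exp_intg(2)[symmetric]) auto
  also have "\<dots> = 0"
    using unb by (intro integral_eq_zero_AE) auto
  finally have cross: "expectation (\<lambda>\<omega>. ?e \<omega> * ?\<xi> \<omega>) = 0" .
  have "expectation ?\<xi> = expectation (real_cond_exp M ?F ?\<xi>)"
    using int by (simp add: F.real_cond_exp_int)
  also have "\<dots> = 0"
    using unb by (intro integral_eq_zero_AE) auto
  finally have mean: "expectation (node_err ?v) = 0"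
    unfolding split using int IHa IHb by simp

  \<comment> \<open>Tower property: averaging the conditional second moment turns it into the
    expected conditional variance at this node.\<close>
  have "expectation (\<lambda>\<omega>. (?\<xi> \<omega>)\<^sup>2) = expectation (real_cond_exp M ?F (\<lambda>\<omega>. (?\<xi> \<omega>)\<^sup>2))"
    using local_err_square_integrable[OF v] by (simp add: F.real_cond_exp_int)
  also have "\<dots> = expectation (\<lambda>\<omega>. cond_var r ?v (pre_rounding r p ?v \<omega>))"
    using local_err_variance[OF v] by (intro integral_cong_AE) auto
  finally have var: "expectation (\<lambda>\<omega>. (?\<xi> \<omega>)\<^sup>2)
      = expectation (\<lambda>\<omega>. cond_var r ?v (pre_rounding r p ?v \<omega>))" .

  \<comment> \<open>Pythagoras is applied twice, first to separate the local error by
    \<open>cross\<close>, then to separate the two child errors by \<open>cross_ab\<close>.\<close>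
  have "expectation (\<lambda>\<omega>. (node_err ?v \<omega>)\<^sup>2)
      = expectation (\<lambda>\<omega>. (node_err a \<omega>)\<^sup>2) + expectation (\<lambda>\<omega>. (node_err b \<omega>)\<^sup>2)
        + expectation (\<lambda>\<omega>. (?\<xi> \<omega>)\<^sup>2)"
    unfolding split
    using IHa IHb int_e2 local_err_square_integrable[OF v] cross cross_ab
    by (simp add: integral_add_square_orthogonal)
  moreover have "integrable M (\<lambda>\<omega>. (node_err ?v \<omega>)\<^sup>2)"
    unfolding split using int_e2 local_err_square_integrable[OF v]
    by (intro integrable_add_square[of ?e]) auto
  moreover have "sum f (rounded r \<inter> set (leaf_list ?v))
      = sum f (rounded r \<inter> set (leaf_list a)) + sum f (rounded r \<inter> set (leaf_list b))"
    for f :: "'l \<Rightarrow> real"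
    using disj by (subst sum.union_disjoint[symmetric]) (auto simp: Int_Un_distrib)
  ultimately show ?case
    using mean var IHa IHb
    by (simp add: sum_internal_nodes_Branch[OF dist] del: pre_rounding.simps)
qed

text \<open>At the root every rounded leaf lies below the node, so the restriction of the leaf sum
  disappears. Integrability is recorded for the later exchange of the integral with the sums over
  entries.\<close>

lemma root_err_moment:
  assumes "distinct (leaf_list T)"
  shows "integrable M (\<lambda>\<omega>. (computed r p T \<omega> - (\<Sum>l\<in>set (leaf_list T). p l))\<^sup>2)"
    and "expectation (\<lambda>\<omega>. (computed r p T \<omega> - (\<Sum>l\<in>set (leaf_list T). p l))\<^sup>2)
      = (\<Sum>l\<in>rounded r.
           expectation (real_cond_exp M (product_algebra M (p l)) (\<lambda>\<omega>. (prod_err r l \<omega>)\<^sup>2)))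
        + (\<Sum>v\<in>internal_nodes T. expectation (\<lambda>\<omega>. cond_var r v (pre_rounding r p v \<omega>)))"
proof -
  have "rounded r \<inter> set (leaf_list T) = rounded r"
    using rounded_subset by blast
  then show "integrable M (\<lambda>\<omega>. (computed r p T \<omega> - (\<Sum>l\<in>set (leaf_list T). p l))\<^sup>2)"
    and "expectation (\<lambda>\<omega>. (computed r p T \<omega> - (\<Sum>l\<in>set (leaf_list T). p l))\<^sup>2)
      = (\<Sum>l\<in>rounded r.
           expectation (real_cond_exp M (product_algebra M (p l)) (\<lambda>\<omega>. (prod_err r l \<omega>)\<^sup>2)))
        + (\<Sum>v\<in>internal_nodes T. expectation (\<lambda>\<omega>. cond_var r v (pre_rounding r p v \<omega>)))"
    using node_err_moments[OF assms subtrees_refl] by (simp_all add: node_err_def)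
qed

end

section \<open>Summation over the matrix entries\<close>

theorem theorem4p1:
  fixes A :: "real^'k^'m" and B :: "real^'n^'k"
    and T :: "'k sum_tree"
    and M :: "'w measure"
    and R :: "'m \<Rightarrow> 'n \<Rightarrow> ('k, 'w, 'd) rounding"
  assumes tree: "full_tree_on UNIV T"
    and model: "\<And>i j. unbiased_rounding M T (exact_prod A B i j) (R i j)"
  shows "(\<integral>\<omega>. (norm (computed_matrix R T A B \<omega> - A ** B))\<^sup>2 \<partial>M)
           = Sigma_p M R A B + Sigma_a M R T A B"
proof -
  have dist: "distinct (leaf_list T)" and leaves: "set (leaf_list T) = UNIV"
    using tree by (auto simp: full_tree_on_def)
  let ?e = "\<lambda>i j \<omega>. computed (R i j) (exact_prod A B i j) T \<omega>
      - (\<Sum>l\<in>set (leaf_list T). exact_prod A B i j l)"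
  \<comment> \<open>The leaves exhaust the index type, so the exact sum at the root is the
    corresponding entry of \<open>A ** B\<close>.\<close>
  have "(norm (computed_matrix R T A B \<omega> - A ** B))\<^sup>2 = (\<Sum>i\<in>UNIV. \<Sum>j\<in>UNIV. (?e i j \<omega>)\<^sup>2)" for \<omega>
    by (simp add: norm_matrix_eq_Frobenius sum_nonneg computed_matrix_def matrix_matrix_mult_def
        exact_prod_def leaves)
  \<comment> \<open>Each squared entry error is integrable, so linearity moves the integral inside
    both finite sums.\<close>
  then have "(\<integral>\<omega>. (norm (computed_matrix R T A B \<omega> - A ** B))\<^sup>2 \<partial>M)
      = (\<Sum>i\<in>UNIV. \<Sum>j\<in>UNIV. \<integral>\<omega>. (?e i j \<omega>)\<^sup>2 \<partial>M)"
    using unbiased_rounding.root_err_moment(1)[OF model dist] by simp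
  also have "\<dots> = Sigma_p M R A B + Sigma_a M R T A B"
    unfolding Sigma_p_def Sigma_a_def unbiased_rounding.root_err_moment(2)[OF model dist]
    by (simp add: sum.distrib)
  finally show ?thesis .
qed

end
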